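(* Let $(F,G)\in\mathcal H_{\mathbf d}[q\,;\,s]$ with $q\leqslant n+1$, $D=\max_i d_i$, and $\kappa_*=\kappa_*(F,G)$. For any positive number $r<\big(13D^{3/2}\kappa_*^2\big)^{-1}$ we have $\mathsf{Approx}(F,G,r)\subseteq\mathcal U_{\mathbb S}\big(S(F,G),3\kappa_*r\big)$.
   Context: $\mathcal H_{\mathbf d}[q]$: $q$-tuples of real homogeneous polynomials in $X_0,\dots,X_n$ of degrees $d_i$ with the Weyl inner product ($\langle h,h'\rangle=\sum_{|a|=d}\binom da^{-1}h_ah'_a$, summed over components); $\mathcal H_{\mathbf d}[q\,;\,s]$: pairs $(F,G)$ of a $q$-tuple and an $s$-tuple. $S(F,G)=\{x\in\mathbb S^n: f(x)=0\ \forall f\in F,\ g(x)\geq0\ \forall g\in G\}$; $\mathcal U_{\mathbb S}(A,r)=\{x\in\mathbb S^n:d_{\mathbb S}(x,A)<r\}$ with $d_{\mathbb S}$ geodesic distance; $\mathsf{Approx}(F,G,r)=\{x\in\mathbb S^n:|f(x)|<\|f\|r\ \forall f\in F,\ g(x)>-\|g\|r\ \forall g\in G\}$. For $x\in\mathbb S^n$: $T_x=\{x\}^\perp$, $\Delta=\mathrm{diag}(\sqrt{d_i})$, $\mu_{\mathrm{proj}}(F,x)=\|F\|\,\|(\mathrm DF(x)|_{T_x})^\dagger\Delta\|$ if $\mathrm DF(x)|_{T_x}$ surjective, else $\infty$; $\kappa(F,x)=(\mu_{\mathrm{proj}}(F,x)^{-2}+\|F(x)\|^2/\|F\|^2)^{-1/2}$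 ($\infty^{-1}=0$, $0^{-1}=\infty$, $\kappa(0,x)=\infty$); $\kappa(F)=\max_x\kappa(F,x)$; $\kappa_*(F,G)=\max\{\kappa(F^L):L\subseteq G,\ q+|L|\leq n+1\}$ where $F^L$ is $F$ with the polynomials of subtuple $L$ appended. *)

theory Defs
  imports "HOL-Analysis.Analysis"
begin

text \<open>Real homogeneous polynomials in the variables X_i, i ranging over a finite
type 'n (so n+1 = CARD('n)).  A polynomial is a pair (d, c) of its degree d and
its coefficient function c on exponent vectors a :: 'n => nat; only the
coefficients with |a| = d are used.\<close>

type_synonym 'n hpoly = "nat \<times> (('n \<Rightarrow> nat) \<Rightarrow> real)"

definition hdeg :: "'n hpoly \<Rightarrow> nat" where "hdeg p = fst p"
definition hcoeff :: "'n hpoly \<Rightarrow> ('n \<Rightarrow> nat) \<Rightarrow> real" where "hcoeff p = snd p"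

definition hmonos :: "nat \<Rightarrow> ('n::finite \<Rightarrow> nat) set" where
  "hmonos d = {a. (\<Sum>i\<in>UNIV. a i) = d}"

definition multinom :: "nat \<Rightarrow> ('n::finite \<Rightarrow> nat) \<Rightarrow> real" where
  "multinom d a = fact d / (\<Prod>i\<in>UNIV. fact (a i))"

definition peval :: "('n::finite) hpoly \<Rightarrow> real^'n \<Rightarrow> real" where
  "peval p x = (\<Sum>a\<in>hmonos (hdeg p). hcoeff p a * (\<Prod>i\<in>UNIV. (x $ i) ^ a i))"

definition wnorm :: "('n::finite) hpoly \<Rightarrow> real" where
  "wnorm p = sqrt (\<Sum>a\<in>hmonos (hdeg p). (hcoeff p a)\<^sup>2 / multinom (hdeg p) a)"

definition tnorm :: "('n::finite) hpoly list \<Rightarrow> real" where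
  "tnorm F = sqrt (\<Sum>f\<leftarrow>F. (wnorm f)\<^sup>2)"

definition sphere_n :: "(real^'n) set" where
  "sphere_n = {x. norm x = 1}"

definition tval :: "('n::finite) hpoly list \<Rightarrow> real^'n \<Rightarrow> real list" where
  "tval F x = map (\<lambda>f. peval f x) F"

definition tderiv :: "('n::finite) hpoly list \<Rightarrow> real^'n \<Rightarrow> real^'n \<Rightarrow> real list" where
  "tderiv F x v = map (\<lambda>f. frechet_derivative (peval f) (at x) v) F"

definition lnorm :: "real list \<Rightarrow> real" where
  "lnorm y = sqrt (\<Sum>t\<leftarrow>y. t\<^sup>2)"

definition tangent :: "real^'n \<Rightarrow> (real^'n) set" where
  "tangent x = {v. x \<bullet> v = 0}"

definition surj_tangent :: "('n::finite) hpoly list \<Rightarrow> real^'n \<Rightarrow> bool" where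
  "surj_tangent F x \<longleftrightarrow> (\<forall>y. length y = length F \<longrightarrow> (\<exists>v\<in>tangent x. tderiv F x v = y))"

text \<open>Moore-Penrose pseudoinverse of DF(x) restricted to T_x (in the surjective case):
the unique preimage orthogonal to the kernel.\<close>
definition pinv :: "('n::finite) hpoly list \<Rightarrow> real^'n \<Rightarrow> real list \<Rightarrow> real^'n" where
  "pinv F x y = (THE w. w \<in> tangent x \<and> tderiv F x w = y \<and>
       (\<forall>u\<in>tangent x. tderiv F x u = map (\<lambda>_. 0) F \<longrightarrow> w \<bullet> u = 0))"

definition Delta :: "('n::finite) hpoly list \<Rightarrow> real list \<Rightarrow> real list" where
  "Delta F y = map (\<lambda>(f, t). sqrt (real (hdeg f)) * t) (zip F y)"

definition pinv_delta_norm :: "('n::finite) hpoly list \<Rightarrow> real^'n \<Rightarrow> real" where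
  "pinv_delta_norm F x = Sup {norm (pinv F x (Delta F y)) | y. length y = length F \<and> lnorm y = 1}"

definition mu_proj :: "('n::finite) hpoly list \<Rightarrow> real^'n \<Rightarrow> ereal" where
  "mu_proj F x = (if surj_tangent F x then ereal (tnorm F * pinv_delta_norm F x) else \<infinity>)"

definition einv :: "ereal \<Rightarrow> ereal" where
  "einv t = (if t = \<infinity> then 0 else if t = 0 then \<infinity> else ereal (1 / real_of_ereal t))"

definition kappa_pt :: "('n::finite) hpoly list \<Rightarrow> real^'n \<Rightarrow> ereal" where
  "kappa_pt F x = (if tnorm F = 0 then \<infinity> else
     (let s = (einv (mu_proj F x))\<^sup>2 + ereal ((lnorm (tval F x))\<^sup>2 / (tnorm F)\<^sup>2)
      in if s = \<infinity> then 0 else einv (ereal (sqrt (real_of_ereal s)))))"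

definition kappa :: "('n::finite) hpoly list \<Rightarrow> ereal" where
  "kappa F = (SUP x\<in>sphere_n. kappa_pt F x)"

definition kappa_star :: "('n::finite) hpoly list \<Rightarrow> 'n hpoly list \<Rightarrow> ereal" where
  "kappa_star F G = (SUP I\<in>{I. I \<subseteq> {..<length G} \<and> length F + card I \<le> CARD('n)}.
      kappa (F @ map (\<lambda>i. G ! i) (sorted_list_of_set I)))"

definition semialg :: "('n::finite) hpoly list \<Rightarrow> 'n hpoly list \<Rightarrow> (real^'n) set" where
  "semialg F G = {x\<in>sphere_n. (\<forall>f\<in>set F. peval f x = 0) \<and> (\<forall>g\<in>set G. peval g x \<ge> 0)}"

definition dist_S :: "real^'n \<Rightarrow> real^'n \<Rightarrow> real" where
  "dist_S x y = arccos (x \<bullet> y)"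

definition U_S :: "(real^'n) set \<Rightarrow> ereal \<Rightarrow> (real^'n) set" where
  "U_S A r = {x\<in>sphere_n. (INF a\<in>A. ereal (dist_S x a)) < r}"

definition Approx :: "('n::finite) hpoly list \<Rightarrow> 'n hpoly list \<Rightarrow> real \<Rightarrow> (real^'n) set" where
  "Approx F G r = {x\<in>sphere_n. (\<forall>f\<in>set F. \<bar>peval f x\<bar> < wnorm f * r) \<and>
                               (\<forall>g\<in>set G. peval g x > - wnorm g * r)}"

end

theory Submission
  imports Defs
begin

text \<open>
Let $\phi(z)$ be the Euclidean norm of all $f(z)$, $f\in F$, and all $\min(g(z),0)$, $g\in G$; its zeros
on the sphere are the points of $S(F,G)$.  For $x$ in the approximate set let $N$ be the norm of $F$ together
with the inequalities violated at $x$, so that $\phi(x) < rN$.  Minimise $\phi(z) + c\,\|z-x\|$ over the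
sphere with $c = 2N/(3\kappa_*)$, as in Ekeland's variational principle.  The minimiser $y$ satisfies
$\|y-x\| \le \phi(x)/c < \frac32\kappa_* r$, and it is a zero of $\phi$: otherwise let $L$ be the set of
inequalities violated at $x$ or at $y$.  Since a polynomial of degree $d$ is $\sqrt d$ times its Weyl norm
Lipschitz on the sphere, all members of $F^L$ are small at $y$, so that finiteness of the condition number
makes $DF^L(y)$ surjective on the tangent space with a right inverse of norm at most about
$\kappa_*/\|F^L\|$.  Hence $\phi$ decreases at $y$ in a tangent direction at a rate larger than $c$,
which contradicts minimality.  Finally, geodesic distance is at most twice the chord.
\<close>

subsection \<open>Reproducing kernel and Lipschitz bounds for the Weyl norm\<close>

lemma finite_hmonos: "finite (hmonos d :: ('n::finite \<Rightarrow> nat) set)"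
proof (rule finite_subset)
  show "hmonos d \<subseteq> Pi\<^sub>E (UNIV::'n set) (\<lambda>_. {..d})"
    by (auto simp: hmonos_def intro: member_le_sum)
qed (auto intro: finite_PiE)

lemma multinom_pos: "multinom d a > 0"
  by (simp add: multinom_def prod_pos)

lemma multinom_Suc:
  fixes a :: "'n::finite \<Rightarrow> nat"
  shows "multinom (Suc d) (a(j := Suc (a j))) * real (Suc (a j)) = real (Suc d) * multinom d a"
proof -
  have e: "(\<Prod>i\<in>UNIV. fact ((a(j := Suc (a j))) i)) = real (Suc (a j)) * (\<Prod>i\<in>UNIV. fact (a i))"
    by (simp add: prod.remove[of UNIV j] del: of_nat_Suc)

  show ?thesis unfolding multinom_def e
    by (simp add: field_simps del: of_nat_Suc)
qed

text \<open>Induction on the degree: multiplying by z_j takes the exponent a to b = a + e_j, and by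
  \<open>multinom_Suc\<close> the new term is the b-term of degree d+1 with weight b_j / (d+1). Over
  all j these weights sum to 1, since |b| = d+1.\<close>

lemma multinomial_theorem:
  fixes z :: "'n::finite \<Rightarrow> real"
  shows "(\<Sum>i\<in>UNIV. z i) ^ d = (\<Sum>a\<in>hmonos d. multinom d a * (\<Prod>i\<in>UNIV. z i ^ a i))"
proof (induction d)
  case 0
  have "hmonos 0 = {\<lambda>_::'n. 0}" by (auto simp: hmonos_def)
  then show ?case by (simp add: multinom_def)
next
  case (Suc d)
  let ?m = "\<lambda>a. \<Prod>i\<in>UNIV. z i ^ a i"
  let ?up = "\<lambda>j (a::'n \<Rightarrow> nat). a(j := Suc (a j))"
  have mon: "?m (?up j a) = z j * ?m a" for j a
    by (simp add: prod.remove[of UNIV j])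
  have step: "(\<Sum>a\<in>hmonos d. multinom d a * ?m a) * z j
      = (\<Sum>b\<in>hmonos (Suc d). multinom (Suc d) b * ?m b * (real (b j) / real (Suc d)))" for j
  proof -
    have inj: "inj_on (?up j) (hmonos d)"
    proof (rule inj_onI)
      fix a a' assume "?up j a = ?up j a'"
      then have "(?up j a)(j := a j) = (?up j a')(j := a j)" "?up j a j = ?up j a' j" by simp_all
      then show "a = a'" by (metis Suc_inject fun_upd_same fun_upd_triv fun_upd_upd)
    qed
    have sumup: "(\<Sum>i\<in>UNIV. ?up j a i) = Suc (\<Sum>i\<in>UNIV. a i)" for a
      by (simp add: sum.remove[of UNIV j])
    \<comment> \<open>Exponents with b_j = 0 are not reached, but there the weight b_j / (d+1)
      vanishes, so the sum extends to all of \<open>hmonos (Suc d)\<close>.\<close>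
    have img: "?up j ` hmonos d = {b \<in> hmonos (Suc d). b j \<noteq> 0}"
    proof (intro equalityI subsetI)
      fix b assume b: "b \<in> {b \<in> hmonos (Suc d). b j \<noteq> 0}"
      define a where "a = b(j := b j - 1)"
      have up: "b = ?up j a" using b by (auto simp: a_def)
      have "Suc (\<Sum>i\<in>UNIV. a i) = Suc d"
        using b unfolding sumup[of a, symmetric] up[symmetric] by (simp add: hmonos_def)
      then have "a \<in> hmonos d" by (simp add: hmonos_def)
      with up show "b \<in> ?up j ` hmonos d" by (rule image_eqI)
    qed (use sumup in \<open>auto simp: hmonos_def\<close>)
    have "(\<Sum>b\<in>hmonos (Suc d). multinom (Suc d) b * ?m b * (real (b j) / real (Suc d)))
      = (\<Sum>b\<in>?up j ` hmonos d. multinom (Suc d) b * ?m b * (real (b j) / real (Suc d)))"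
      unfolding img by (rule sum.mono_neutral_right) (auto simp: finite_hmonos)
    also have "\<dots> = (\<Sum>a\<in>hmonos d. multinom d a * ?m a * z j)"
      unfolding sum.reindex[OF inj] o_def mon
    proof (intro sum.cong refl)
      fix a
      have "multinom (Suc d) (?up j a) * real (Suc (a j)) / real (Suc d) = multinom d a"
        unfolding multinom_Suc by simp
      then show "multinom (Suc d) (?up j a) * (z j * ?m a) * (real (?up j a j) / real (Suc d))
        = multinom d a * ?m a * z j"
        by (simp add: field_simps del: of_nat_Suc)
    qed
    finally show ?thesis unfolding sum_distrib_right ..
  qed
  have "(\<Sum>i\<in>UNIV. z i) ^ Suc d = (\<Sum>j\<in>UNIV. (\<Sum>a\<in>hmonos d. multinom d a * ?m a) * z j)"
    unfolding power_Suc Suc by (subst mult.commute) (rule sum_distrib_left)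
  also have "\<dots> = (\<Sum>b\<in>hmonos (Suc d). multinom (Suc d) b * ?m b * (real (\<Sum>j\<in>UNIV. b j) / real (Suc d)))"
    unfolding step by (subst sum.swap) (simp add: sum_distrib_left sum_divide_distrib)
  also have "\<dots> = (\<Sum>b\<in>hmonos (Suc d). multinom (Suc d) b * ?m b)"
    by (intro sum.cong refl) (simp add: hmonos_def del: of_nat_Suc)
  finally show ?case .
qed

definition monom_ev :: "('n::finite \<Rightarrow> nat) \<Rightarrow> real^'n \<Rightarrow> real" where
  "monom_ev a x = (\<Prod>i\<in>UNIV. (x $ i) ^ a i)"

text \<open>The reproducing kernel of the Weyl inner product: the multinomial theorem with z_i = x_i
  y_i.\<close>

lemma monom_kernel:
  "(\<Sum>a\<in>hmonos d. multinom d a * (monom_ev a x * monom_ev a y)) = (x \<bullet> y) ^ d"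
  by (simp add: inner_vec_def multinomial_theorem monom_ev_def power_mult_distrib prod.distrib)

lemma wnorm_nonneg: "wnorm p \<ge> 0"
  by (simp add: wnorm_def sum_nonneg multinom_pos less_imp_le)

text \<open>The weights \<open>multinom\<close> are reciprocal to those of the Weyl norm, so the
  second factor is a dual norm; for combinations of point evaluations the kernel computes
  it.\<close>

lemma wnorm_Cauchy_Schwarz:
  "\<bar>\<Sum>a\<in>hmonos (hdeg p). hcoeff p a * z a\<bar>
    \<le> wnorm p * sqrt (\<Sum>a\<in>hmonos (hdeg p). multinom (hdeg p) a * (z a)\<^sup>2)"
proof -
  let ?m = "multinom (hdeg p)"
  have "\<bar>\<Sum>a\<in>hmonos (hdeg p). hcoeff p a * z a\<bar>
      = \<bar>\<Sum>a\<in>hmonos (hdeg p). (hcoeff p a / sqrt (?m a)) * (sqrt (?m a) * z a)\<bar>"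
  proof (intro arg_cong[where f = abs] sum.cong refl)
    fix a
    show "hcoeff p a * z a = (hcoeff p a / sqrt (?m a)) * (sqrt (?m a) * z a)"
      using multinom_pos[of "hdeg p" a] by simp
  qed
  also have "\<dots> \<le> (\<Sum>a\<in>hmonos (hdeg p). \<bar>hcoeff p a / sqrt (?m a)\<bar> * \<bar>sqrt (?m a) * z a\<bar>)"
    by (rule order_trans[OF sum_abs]) (simp only: abs_mult order_refl)
  also have "\<dots> \<le> L2_set (\<lambda>a. hcoeff p a / sqrt (?m a)) (hmonos (hdeg p))
      * L2_set (\<lambda>a. sqrt (?m a) * z a) (hmonos (hdeg p))"
    by (rule L2_set_mult_ineq)
  also have "\<dots> = wnorm p * sqrt (\<Sum>a\<in>hmonos (hdeg p). ?m a * (z a)\<^sup>2)"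
    by (simp add: L2_set_def wnorm_def power_divide power_mult_distrib less_imp_le[OF multinom_pos])
  finally show ?thesis .
qed

lemma peval_bound:
  assumes "norm x = 1" shows "\<bar>peval p x\<bar> \<le> wnorm p"
proof -
  have "(\<Sum>a\<in>hmonos (hdeg p). multinom (hdeg p) a * (monom_ev a x)\<^sup>2) = 1"
    using monom_kernel[of "hdeg p" x x] assms by (simp add: power2_eq_square dot_square_norm)
  then show ?thesis
    using wnorm_Cauchy_Schwarz[of p "\<lambda>a. monom_ev a x"] by (simp add: peval_def monom_ev_def)
qed

text \<open>The dual norm of evaluation at x minus evaluation at y has square 2 (1 - t^d) with t = x
  . y, by the kernel formula. The geometric sum bounds this by 2 d (1 - t) = d |x - y|^2.\<close>

lemma peval_lipschitz:
  assumes "norm x = 1" "norm y = 1"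
  shows "\<bar>peval p x - peval p y\<bar> \<le> wnorm p * sqrt (hdeg p) * norm (x - y)"
proof -
  let ?d = "hdeg p" and ?t = "x \<bullet> y"
  have t: "\<bar>?t\<bar> \<le> 1" using Cauchy_Schwarz_ineq2[of x y] assms by simp
  have "1 - ?t ^ ?d = (1 - ?t) * (\<Sum>i<?d. ?t ^ i)"
    by (rule one_diff_power_eq)
  also have "\<dots> \<le> (1 - ?t) * ?d"
  proof (rule mult_left_mono)
    have "(\<Sum>i<?d. ?t ^ i) \<le> (\<Sum>i<?d. 1)"
    proof (rule sum_mono)
      fix i
      have "?t ^ i \<le> \<bar>?t\<bar> ^ i" by (metis abs_ge_self power_abs)
      also have "\<dots> \<le> 1" using t by (simp add: power_le_one)
      finally show "?t ^ i \<le> 1" .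
    qed
    then show "(\<Sum>i<?d. ?t ^ i) \<le> ?d" by simp
  qed (use t in auto)
  finally have pow: "1 - ?t ^ ?d \<le> ?d * (1 - ?t)" by (simp add: mult.commute)
  have nxy: "(norm (x - y))\<^sup>2 = 2 * (1 - ?t)"
    using assms by (simp add: power2_norm_eq_inner inner_diff inner_commute norm_eq_1)
  let ?z = "\<lambda>a. monom_ev a x - monom_ev a y"
  have "(\<Sum>a\<in>hmonos ?d. multinom ?d a * (?z a)\<^sup>2)
     = (x \<bullet> x) ^ ?d + (y \<bullet> y) ^ ?d - 2 * ?t ^ ?d"
    unfolding monom_kernel[symmetric]
    by (simp add: power2_eq_square algebra_simps sum.distrib sum_subtractf sum_distrib_left)
  also have "\<dots> \<le> ?d * (norm (x - y))\<^sup>2"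
    unfolding nxy using pow assms by (simp only: norm_eq_1 power_one)
  finally have "sqrt (\<Sum>a\<in>hmonos ?d. multinom ?d a * (?z a)\<^sup>2) \<le> sqrt ?d * norm (x - y)"
    by (intro real_le_lsqrt) (simp_all add: power_mult_distrib)
  then have "wnorm p * sqrt (\<Sum>a\<in>hmonos ?d. multinom ?d a * (?z a)\<^sup>2) \<le> wnorm p * sqrt ?d * norm (x - y)"
    by (simp add: mult_left_mono wnorm_nonneg mult.assoc)
  moreover have "peval p x - peval p y = (\<Sum>a\<in>hmonos ?d. hcoeff p a * ?z a)"
    by (simp add: peval_def monom_ev_def sum_subtractf right_diff_distrib)
  ultimately show ?thesis
    using wnorm_Cauchy_Schwarz[of p ?z] by linarith
qed

subsection \<open>Derivatives along great circles\<close>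

lemma peval_differentiable: "peval p differentiable at x"
proof -
  have nth: "(\<lambda>x::real^'a. x $ i) differentiable at x" for i
    using bounded_linear_imp_has_derivative[OF bounded_linear_vec_nth] differentiableI by blast
  have "(\<lambda>x. \<Prod>i\<in>UNIV. (x $ i) ^ a i) differentiable at x" for a :: "'a \<Rightarrow> nat"
  proof -
    have "(\<lambda>x. \<Prod>i\<in>I. (x $ i) ^ a i) differentiable at x" if "finite I" for I
      using that by induction (auto intro!: differentiable_mult differentiable_power nth)
    then show ?thesis by simp
  qed
  then show ?thesis
    unfolding peval_def by (auto intro!: differentiable_sum finite_hmonos)
qed

lemma frechet_peval: "(peval p has_derivative frechet_derivative (peval p) (at x)) (at x)"
  using peval_differentiable frechet_derivative_works by blast

lemma linear_frechet_peval: "linear (frechet_derivative (peval p) (at x))"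
  using frechet_peval has_derivative_linear by blast

lemma continuous_on_peval: "continuous_on S (peval p)"
  unfolding peval_def by (intro continuous_intros)

text \<open>For a unit vector v orthogonal to x this is the great circle through x with initial
  velocity v, traversed at unit speed.\<close>

definition geo :: "real^'n \<Rightarrow> real^'n \<Rightarrow> real \<Rightarrow> real^'n" where
  "geo x v t = cos t *\<^sub>R x + sin t *\<^sub>R v"

lemma geo_0 [simp]: "geo x v 0 = x"
  by (simp add: geo_def)

lemma norm_geo:
  assumes "norm x = 1" "norm v = 1" "x \<bullet> v = 0"
  shows "norm (geo x v t) = 1"
proof -
  have "geo x v t \<bullet> geo x v t = (cos t)\<^sup>2 + (sin t)\<^sup>2"
    using assms by (simp add: geo_def inner_add inner_commute norm_eq_1 power2_eq_square)
  then show ?thesis by (simp add: norm_eq_1)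
qed

lemma norm_geo_diff:
  assumes "norm x = 1" "norm v = 1" "x \<bullet> v = 0"
  shows "norm (geo x v t - x) \<le> \<bar>t\<bar>"
proof -
  have "(norm (geo x v t - x))\<^sup>2 = 2 * (1 - cos t)"
    using norm_geo[OF assms, of t] assms
    by (simp add: power2_norm_eq_inner inner_diff inner_commute norm_eq_1)
       (simp add: geo_def inner_add norm_eq_1 inner_commute)
  also have "\<dots> = 4 * (sin (t/2))\<^sup>2"
    using cos_double_sin[of "t/2"] by simp
  also have "\<dots> \<le> 4 * (t/2)\<^sup>2"
    using abs_sin_x_le_abs_x[of "t/2"] by (simp only: abs_le_square_iff)
  also have "\<dots> = \<bar>t\<bar>\<^sup>2" by (simp add: power_divide)
  finally show ?thesis by (simp only: abs_le_square_iff[symmetric] abs_norm_cancel abs_idempotent)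
qed

lemma peval_geo_deriv:
  "((\<lambda>t. peval p (geo x v t)) has_real_derivative frechet_derivative (peval p) (at x) v) (at 0)"
proof -
  have g: "(geo x v has_derivative (\<lambda>h. h *\<^sub>R v)) (at 0)"
    unfolding geo_def by (auto intro!: derivative_eq_intros)
  have "((\<lambda>t. peval p (geo x v t)) has_derivative
      (\<lambda>h. frechet_derivative (peval p) (at x) (h *\<^sub>R v))) (at 0)"
    by (rule has_derivative_compose[OF g]) (simp add: frechet_peval)
  then show ?thesis
    by (simp add: has_field_derivative_def linear_frechet_peval linear_scale mult.commute[of _ "frechet_derivative _ _ _"])
qed

text \<open>In a unit tangent direction the derivative is a limit of difference quotients along the
  great circle, and these inherit the Lipschitz bound because a chord is at most its arc.\<close>

lemma frechet_peval_bound: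
  fixes x :: "real^'n::finite"
  assumes x: "norm x = 1" and v: "x \<bullet> v = 0"
  shows "\<bar>frechet_derivative (peval p) (at x) v\<bar> \<le> wnorm p * sqrt (hdeg p) * norm v"
proof (cases "v = 0")
  case True
  then show ?thesis by (simp add: linear_0[OF linear_frechet_peval])
next
  case False
  define u where "u = v /\<^sub>R norm v"
  have u: "norm u = 1" "x \<bullet> u = 0" using False v by (auto simp: u_def)
  let ?D = "frechet_derivative (peval p) (at x)"
  have "((\<lambda>t. (peval p (geo x u t) - peval p x) / t) \<longlongrightarrow> ?D u) (at 0)"
    using peval_geo_deriv[of p x u] by (simp add: DERIV_def)
  then have "((\<lambda>t. \<bar>(peval p (geo x u t) - peval p x) / t\<bar>) \<longlongrightarrow> \<bar>?D u\<bar>) (at 0)"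
    by (rule tendsto_rabs)
  moreover have "\<forall>\<^sub>F t in at 0. \<bar>(peval p (geo x u t) - peval p x) / t\<bar> \<le> wnorm p * sqrt (hdeg p)"
  proof (rule eventually_mono[OF eventually_at_in_open'[of UNIV]])
    fix t :: real assume "t \<in> UNIV"
    have "\<bar>peval p (geo x u t) - peval p x\<bar> \<le> wnorm p * sqrt (hdeg p) * norm (geo x u t - x)"
      by (rule peval_lipschitz) (use x u norm_geo in auto)
    also have "\<dots> \<le> wnorm p * sqrt (hdeg p) * \<bar>t\<bar>"
      using norm_geo_diff[OF x u] by (simp add: mult_left_mono wnorm_nonneg)
    finally show "\<bar>(peval p (geo x u t) - peval p x) / t\<bar> \<le> wnorm p * sqrt (hdeg p)"
      by (cases "t = 0") (auto simp: abs_divide field_simps wnorm_nonneg)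
  qed auto
  ultimately have "\<bar>?D u\<bar> \<le> wnorm p * sqrt (hdeg p)"
    by (rule tendsto_upperbound) simp
  moreover have "?D v = norm v * ?D u"
    using False linear_scale[OF linear_frechet_peval, of p x "norm v" u] by (simp add: u_def)
  ultimately show ?thesis
    by (simp add: abs_mult mult.commute mult_left_mono)
qed

subsection \<open>The pseudoinverse on the tangent space\<close>

lemma sum_list_map_eq_sum_nth: "(\<Sum>y\<leftarrow>ys. h y) = (\<Sum>i<length ys. h (ys ! i))"
  by (simp add: sum_list_sum_nth atLeast0LessThan)

lemma lnorm_eq_L2: "lnorm y = L2_set ((!) y) {..<length y}"
  by (simp add: lnorm_def L2_set_def sum_list_map_eq_sum_nth)

lemma tnorm_eq_L2: "tnorm F = L2_set (\<lambda>i. wnorm (F ! i)) {..<length F}"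
  by (simp add: tnorm_def L2_set_def sum_list_map_eq_sum_nth)

lemma lnorm_nonneg: "lnorm y \<ge> 0"
  by (simp add: lnorm_eq_L2 L2_set_nonneg)

lemma tnorm_nonneg: "tnorm F \<ge> 0"
  by (simp add: tnorm_eq_L2 L2_set_nonneg)

lemma lnorm_tval_le:
  assumes "\<And>h. h \<in> set F \<Longrightarrow> \<bar>peval h x\<bar> \<le> e * wnorm h" "0 \<le> e"
  shows "lnorm (tval F x) \<le> e * tnorm F"
proof -
  have "lnorm (tval F x) = L2_set (\<lambda>i. \<bar>peval (F!i) x\<bar>) {..<length F}"
    by (simp add: lnorm_eq_L2 tval_def L2_set_def)
  also have "\<dots> \<le> L2_set (\<lambda>i. e * wnorm (F!i)) {..<length F}"
    by (rule L2_set_mono) (use assms in auto)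
  also have "\<dots> = e * tnorm F"
    using assms by (simp add: tnorm_eq_L2 L2_set_right_distrib)
  finally show ?thesis .
qed

lemma wnorm_le_tnorm: "f \<in> set F \<Longrightarrow> wnorm f \<le> tnorm F"
  by (auto simp: tnorm_eq_L2 in_set_conv_nth wnorm_nonneg intro: member_le_L2_set)

lemma length_tderiv [simp]: "length (tderiv F x v) = length F"
  by (simp add: tderiv_def)

lemma nth_tderiv: "i < length F \<Longrightarrow> tderiv F x v ! i = frechet_derivative (peval (F!i)) (at x) v"
  by (simp add: tderiv_def)

lemma tderiv_eq_iff:
  "length y = length F \<Longrightarrow> tderiv F x v = y \<longleftrightarrow>
     (\<forall>i<length F. frechet_derivative (peval (F!i)) (at x) v = y ! i)"
  by (auto simp: list_eq_iff_nth_eq nth_tderiv)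

lemma length_Delta: "length y = length F \<Longrightarrow> length (Delta F y) = length F"
  by (simp add: Delta_def)

lemma nth_Delta: "length y = length F \<Longrightarrow> i < length F \<Longrightarrow> Delta F y ! i = sqrt (hdeg (F!i)) * y ! i"
  by (simp add: Delta_def)

definition tkernel :: "('n::finite) hpoly list \<Rightarrow> real^'n \<Rightarrow> (real^'n) set" where
  "tkernel F x = {u \<in> tangent x. tderiv F x u = map (\<lambda>_. 0) F}"

lemma mem_tkernel_iff:
  "u \<in> tkernel F x \<longleftrightarrow> x \<bullet> u = 0 \<and> (\<forall>i<length F. frechet_derivative (peval (F!i)) (at x) u = 0)"
  by (auto simp: tkernel_def tangent_def tderiv_eq_iff)

lemma subspace_tkernel: "subspace (tkernel F x)"
  unfolding subspace_def
  by (auto simp: mem_tkernel_iff linear_0[OF linear_frechet_peval] linear_add[OF linear_frechet_peval]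
      linear_scale[OF linear_frechet_peval] inner_add)

lemma diff_mem_tkernel:
  assumes "v \<in> tangent x" "w \<in> tangent x" "tderiv F x v = tderiv F x w"
  shows "v - w \<in> tkernel F x"
proof -
  have "frechet_derivative (peval (F!i)) (at x) v = frechet_derivative (peval (F!i)) (at x) w"
    if "i < length F" for i using assms(3) that by (metis nth_tderiv)
  then show ?thesis
    using assms(1,2) by (auto simp: mem_tkernel_iff tangent_def inner_diff linear_diff[OF linear_frechet_peval])
qed

text \<open>Any tangent preimage v makes the \<open>THE\<close> in \<open>pinv\<close> meaningful:
  its component orthogonal to the kernel is the unique preimage with that orthogonality, and
  Pythagoras makes it no longer than v.\<close>

lemma pinv_properties:
  assumes "v \<in> tangent x" "tderiv F x v = y"
  shows "pinv F x y \<in> tangent x" "tderiv F x (pinv F x y) = y" "norm (pinv F x y) \<le> norm v"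
proof -
  let ?P = "\<lambda>w. w \<in> tangent x \<and> tderiv F x w = y \<and>
       (\<forall>u\<in>tangent x. tderiv F x u = map (\<lambda>_. 0) F \<longrightarrow> w \<bullet> u = 0)"
  have P: "?P w \<longleftrightarrow> w \<in> tangent x \<and> tderiv F x w = y \<and> (\<forall>u\<in>tkernel F x. w \<bullet> u = 0)" for w
    by (auto simp: tkernel_def)
  obtain k w where kw: "k \<in> span (tkernel F x)" "\<And>u. u \<in> span (tkernel F x) \<Longrightarrow> orthogonal w u" "v = k + w"
    using orthogonal_subspace_decomp_exists[of "tkernel F x" v] by metis
  have sp: "span (tkernel F x) = tkernel F x" by (simp add: span_eq_iff subspace_tkernel)
  have k: "k \<in> tkernel F x" "w = v - k" using kw sp by auto
  have Pw: "?P w" unfolding P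
  proof (intro conjI ballI)
    show "w \<in> tangent x" using k assms by (auto simp: tangent_def mem_tkernel_iff inner_diff)
    have "tderiv F x w = tderiv F x v"
      using k by (subst tderiv_eq_iff) (auto simp: nth_tderiv mem_tkernel_iff linear_diff[OF linear_frechet_peval])
    then show "tderiv F x w = y" using assms by simp
  qed (use kw sp in \<open>auto simp: orthogonal_def\<close>)
  have uniq: "w' = w" if "?P w'" for w'
  proof -
    have "w' - w \<in> tkernel F x" using Pw that by (intro diff_mem_tkernel) auto
    then have "w' \<bullet> (w' - w) = 0" "w \<bullet> (w' - w) = 0" using that Pw unfolding P by auto
    then have "(w' - w) \<bullet> (w' - w) = 0" by (simp add: inner_diff)
    then show ?thesis by simp
  qed
  have pw: "pinv F x y = w"
    unfolding pinv_def by (rule the_equality[where P = ?P, OF Pw uniq])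
  show "pinv F x y \<in> tangent x" "tderiv F x (pinv F x y) = y" unfolding pw using Pw by auto
  have "w \<bullet> k = 0" using kw by (auto simp: orthogonal_def)
  then have "(norm v)\<^sup>2 = (norm k)\<^sup>2 + (norm w)\<^sup>2"
    unfolding kw(3) by (simp add: power2_norm_eq_inner inner_add inner_commute)
  then have "(norm w)\<^sup>2 \<le> (norm v)\<^sup>2" by simp
  then show "norm (pinv F x y) \<le> norm v" unfolding pw by (simp add: abs_le_square_iff[symmetric])
qed

lemma lnorm_scale: "lnorm (map ((*) c) y) = \<bar>c\<bar> * lnorm y"
proof -
  have "(\<Sum>t\<leftarrow>map ((*) c) y. t\<^sup>2) = c\<^sup>2 * (\<Sum>t\<leftarrow>y. t\<^sup>2)"
    by (simp add: sum_list_const_mult o_def power_mult_distrib)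
  then show ?thesis by (simp add: lnorm_def real_sqrt_mult)
qed

text \<open>The supremum defining \<open>pinv_delta_norm\<close> carries information only for a
  bounded set. Combining fixed preimages of the unit vectors gives preimages of uniformly bounded
  norm, and \<open>pinv\<close> is no longer than these.\<close>

lemma pinv_delta_bdd:
  assumes "surj_tangent F x"
  shows "bdd_above {norm (pinv F x (Delta F y)) | y. length y = length F \<and> lnorm y = 1}"
proof -
  let ?e = "\<lambda>i. map (\<lambda>j. if i = j then 1 else 0) [0..<length F]"
  have "\<forall>i. \<exists>v\<in>tangent x. tderiv F x v = ?e i"
    using assms by (simp add: surj_tangent_def)
  then obtain v where v: "\<And>i. v i \<in> tangent x" "\<And>i. tderiv F x (v i) = ?e i" by metis
  have Dv: "frechet_derivative (peval (F!j)) (at x) (v i) = (if i = j then 1 else 0)" if "j < length F" for i j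
    using v(2)[of i] that by (subst (asm) tderiv_eq_iff) auto
  have "norm (pinv F x (Delta F y)) \<le> (\<Sum>i<length F. sqrt (hdeg (F!i)) * norm (v i))"
    if y: "length y = length F" "lnorm y = 1" for y
  proof -
    let ?w = "\<Sum>i<length F. (Delta F y ! i) *\<^sub>R v i"
    have "?w \<in> tangent x" using v(1) by (auto simp: tangent_def inner_sum_right)
    moreover have "tderiv F x ?w = Delta F y"
      using y by (subst tderiv_eq_iff)
        (auto simp: length_Delta linear_sum[OF linear_frechet_peval] linear_scale[OF linear_frechet_peval] Dv if_distrib cong: if_cong)
    ultimately have "norm (pinv F x (Delta F y)) \<le> norm ?w" by (rule pinv_properties)
    also have "\<dots> \<le> (\<Sum>i<length F. norm ((Delta F y ! i) *\<^sub>R v i))" by (rule norm_sum)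
    also have "\<dots> \<le> (\<Sum>i<length F. sqrt (hdeg (F!i)) * norm (v i))"
    proof (rule sum_mono)
      fix i assume "i \<in> {..<length F}"
      then have i: "i < length F" by simp
      have "\<bar>y ! i\<bar> \<le> lnorm y"
        using member_le_L2_set[of "{..<length y}" i "\<lambda>i. \<bar>y ! i\<bar>"] i y by (simp add: lnorm_eq_L2 L2_set_def)
      then show "norm ((Delta F y ! i) *\<^sub>R v i) \<le> sqrt (hdeg (F!i)) * norm (v i)"
        using i y by (auto simp: nth_Delta abs_mult intro!: mult_right_mono mult_left_le)
    qed
    finally show ?thesis .
  qed
  then show ?thesis by (intro bdd_aboveI) auto
qed

lemma norm_pinv_Delta_le:
  assumes "surj_tangent F x" "length y = length F"
  shows "norm (pinv F x (Delta F y)) \<le> pinv_delta_norm F x * lnorm y"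
proof (cases "lnorm y = 0")
  case True
  then have "\<forall>i<length F. y ! i = 0" using assms(2) by (simp add: lnorm_eq_L2 L2_set_eq_0_iff)
  then have "tderiv F x 0 = Delta F y"
    using assms by (subst tderiv_eq_iff) (auto simp: length_Delta nth_Delta linear_0[OF linear_frechet_peval])
  then have "norm (pinv F x (Delta F y)) \<le> norm (0::real^'a)"
    by (intro pinv_properties) (auto simp: tangent_def)
  then show ?thesis using True by simp
next
  case False
  let ?l = "lnorm y"
  have l: "?l > 0" using False lnorm_nonneg[of y] by simp
  let ?u = "map ((*) (1/?l)) y"
  have u: "length ?u = length F" "lnorm ?u = 1"
    using l assms unfolding lnorm_scale by auto
  have "norm (pinv F x (Delta F ?u)) \<le> pinv_delta_norm F x"
    unfolding pinv_delta_norm_def by (rule cSup_upper) (use u pinv_delta_bdd[OF assms(1)] in auto)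
  then have "?l * norm (pinv F x (Delta F ?u)) \<le> ?l * pinv_delta_norm F x"
    using l by (intro mult_left_mono) auto
  \<comment> \<open>The rescaled pseudoinverse of the normalised vector is a preimage of
    \<open>Delta F y\<close>, so minimality of the norm gives the inequality.\<close>
  moreover have "norm (pinv F x (Delta F y)) \<le> norm (?l *\<^sub>R pinv F x (Delta F ?u))"
  proof (rule pinv_properties(3))
    obtain v where v: "v \<in> tangent x" "tderiv F x v = Delta F ?u"
      using assms(1) length_Delta[OF u(1)] unfolding surj_tangent_def by metis
    note p = pinv_properties[OF v]
    show "?l *\<^sub>R pinv F x (Delta F ?u) \<in> tangent x" using p(1) by (simp add: tangent_def)
    have "frechet_derivative (peval (F!i)) (at x) (pinv F x (Delta F ?u)) = Delta F ?u ! i" if "i < length F" for i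
      using p(2) that by (metis nth_tderiv)
    then show "tderiv F x (?l *\<^sub>R pinv F x (Delta F ?u)) = Delta F y"
      using assms u l by (subst tderiv_eq_iff)
        (auto simp: length_Delta nth_Delta linear_scale[OF linear_frechet_peval])
  qed
  ultimately show ?thesis
    unfolding norm_scaleR abs_of_pos[OF l] mult.commute[of "pinv_delta_norm F x"] by linarith
qed

text \<open>This is mu_proj >= 1. For the first unit vector, the preimage w satisfies Df(x) w = sqrt
  d for the first polynomial f, while |Df(x) w| <= |f| sqrt d |w|; since d >= 1, cancelling sqrt d
  gives |f| |w| >= 1.\<close>

lemma pinv_delta_norm_ge:
  assumes "surj_tangent F x" "norm x = 1" "F \<noteq> []" "\<forall>f\<in>set F. 1 \<le> hdeg f"
  shows "1 \<le> pinv_delta_norm F x * tnorm F"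
proof -
  let ?y = "map (\<lambda>i. if i = 0 then 1 else 0::real) [0..<length F]"
  let ?w = "pinv F x (Delta F ?y)"
  have F0: "0 < length F" using assms by simp
  have l: "lnorm ?y = 1"
  proof -
    have "(\<Sum>i<length F. (if i = 0 then 1 else 0::real)\<^sup>2) = (\<Sum>i<length F. if i = 0 then 1 else 0)"
      by (intro sum.cong) auto
    also have "\<dots> = 1" using F0 by (subst sum.delta) auto
    finally show ?thesis by (simp add: lnorm_eq_L2 L2_set_def)
  qed
  obtain v where v: "v \<in> tangent x" "tderiv F x v = Delta F ?y"
    using assms(1) length_Delta[of ?y F] unfolding surj_tangent_def by auto
  note p = pinv_properties[OF v]
  have d: "hdeg (F!0) \<ge> 1" using assms F0 nth_mem by blast
  have "frechet_derivative (peval (F!0)) (at x) ?w = sqrt (hdeg (F!0))"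
    unfolding nth_tderiv[OF F0, symmetric] p(2) using F0 by (simp add: nth_Delta)
  then have "sqrt (hdeg (F!0)) \<le> wnorm (F!0) * sqrt (hdeg (F!0)) * norm ?w"
    using frechet_peval_bound[OF assms(2), of ?w "F!0"] p(1) by (simp add: tangent_def)
  then have "sqrt (hdeg (F!0)) * 1 \<le> sqrt (hdeg (F!0)) * (wnorm (F!0) * norm ?w)" by (simp add: mult_ac)
  then have "1 \<le> wnorm (F!0) * norm ?w" using d by (subst (asm) mult_le_cancel_left_pos) auto
  also have "\<dots> \<le> tnorm F * pinv_delta_norm F x"
    using norm_pinv_Delta_le[OF assms(1), of ?y] l F0
    by (intro mult_mono wnorm_le_tnorm) (auto simp: wnorm_nonneg tnorm_nonneg)
  finally show ?thesis by (simp add: mult.commute)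
qed

text \<open>A dimension count. If n+1 derivatives were jointly onto from the tangent space, the
  whole derivative would be an injective endomorphism; its value at x would then also be attained at
  a tangent vector, which would have to be x itself.\<close>

lemma not_surj_tangent_square:
  fixes x :: "real^'n::finite"
  assumes "length F = CARD('n)" "norm x = 1"
  shows "\<not> surj_tangent F x"
proof
  assume s: "surj_tangent F x"
  obtain b :: "'n \<Rightarrow> nat" where b: "bij_betw b UNIV {..<CARD('n)}"
    using ex_bij_betw_finite_nat[of "UNIV::'n set"] by (auto simp: atLeast0LessThan)
  let ?A = "\<lambda>v. (\<chi> j. frechet_derivative (peval (F ! b j)) (at x) v)"
  have lin: "linear ?A"
    by (rule linearI) (auto simp: vec_eq_iff linear_add[OF linear_frechet_peval] linear_scale[OF linear_frechet_peval])
  have ex: "\<exists>v\<in>tangent x. ?A v = z" for z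
  proof -
    let ?y = "map (\<lambda>i. z $ (inv_into UNIV b i)) [0..<length F]"
    have "length ?y = length F" by simp
    then obtain v where v: "v \<in> tangent x" "tderiv F x v = ?y" using s unfolding surj_tangent_def by blast
    have "frechet_derivative (peval (F ! b j)) (at x) v = z $ j" for j
    proof -
      have "b j < length F" using b assms by (auto simp: bij_betw_def)
      then have "frechet_derivative (peval (F ! b j)) (at x) v = ?y ! b j" using v(2) by (metis nth_tderiv)
      also have "\<dots> = z $ j" using \<open>b j < length F\<close> b by (simp add: bij_betw_def)
      finally show ?thesis .
    qed
    then show ?thesis using v by (auto simp: vec_eq_iff)
  qed
  then have "surj ?A" unfolding surj_def by (metis (no_types))
  then have inj: "inj ?A" using lin linear_surjective_imp_injective by blast
  obtain v where v: "v \<in> tangent x" "?A v = ?A x" using ex by blast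
  have "v = x" by (rule injD[OF inj v(2)])
  then have "x \<in> tangent x" using v by simp
  then show False using assms by (simp add: tangent_def norm_eq_1)
qed

subsection \<open>Condition numbers\<close>

text \<open>Removes the extended reals inside the root: mu_proj is never 0 because it is at least 1,
  so its inverse is a real number, equal to 0 when surjectivity fails.\<close>

lemma kappa_pt_eq:
  fixes x :: "real^'n::finite"
  assumes "tnorm F \<noteq> 0" "norm x = 1" "\<forall>f\<in>set F. 1 \<le> hdeg f"
  shows "kappa_pt F x = einv (ereal (sqrt ((if surj_tangent F x then 1 / (pinv_delta_norm F x * tnorm F) else 0)\<^sup>2
           + (lnorm (tval F x) / tnorm F)\<^sup>2)))"
proof -
  have "F \<noteq> []" using assms(1) by (auto simp: tnorm_def)
  then have "pinv_delta_norm F x * tnorm F \<noteq> 0" if "surj_tangent F x"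
    using pinv_delta_norm_ge[OF that assms(2) _ assms(3)] by auto
  then have e: "einv (mu_proj F x) = ereal (if surj_tangent F x then 1 / (pinv_delta_norm F x * tnorm F) else 0)"
    by (simp add: mu_proj_def einv_def mult.commute)
  show ?thesis
    unfolding kappa_pt_def e using assms(1) by (simp add: Let_def power2_eq_square power_divide)
qed

lemma kappa_pt_le_imp:
  fixes x :: "real^'n::finite"
  assumes "tnorm F \<noteq> 0" "norm x = 1" "\<forall>f\<in>set F. 1 \<le> hdeg f" "kappa_pt F x \<le> ereal K"
  shows "0 < K" "1 / K\<^sup>2 \<le> (if surj_tangent F x then 1 / (pinv_delta_norm F x * tnorm F) else 0)\<^sup>2
           + (lnorm (tval F x) / tnorm F)\<^sup>2" (is "_ \<le> ?s")
proof -
  have le: "einv (ereal (sqrt ?s)) \<le> ereal K"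
    using assms kappa_pt_eq by metis
  \<comment> \<open>A zero radicand would make the condition number infinite, since
    \<open>einv 0\<close> is infinite.\<close>
  then have s0: "?s \<noteq> 0" by (auto simp: einv_def)
  moreover have "?s \<ge> 0" by simp
  ultimately have s: "?s > 0" by linarith
  then have sq: "sqrt ?s > 0" by (rule real_sqrt_gt_zero)
  have inv: "1 / sqrt ?s \<le> K"
    using le sq by (simp only: einv_def) (simp split: if_splits)
  then show K: "0 < K" using sq by (meson divide_pos_pos less_le_trans zero_less_one)
  have "1 / K \<le> sqrt ?s" using inv sq K by (simp add: field_simps)
  then have "(1 / K)\<^sup>2 \<le> (sqrt ?s)\<^sup>2" using K by (intro power_mono) auto
  then show "1 / K\<^sup>2 \<le> ?s" using s by (simp only: real_sqrt_pow2 less_imp_le power_divide power_one)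
qed

text \<open>Since $\mu_{\mathrm{proj}}^{-1}\le 1$ and $\|F(x)\|\le\|F\|$, the radicand in the definition of
$\kappa$ is at most 2; this gives $\kappa\ge 1/\sqrt2$, which suffices in place of the sharp $\kappa\ge 1$.\<close>
lemma kappa_pt_lower_bound:
  fixes x :: "real^'n::finite"
  assumes "tnorm F \<noteq> 0" "norm x = 1" "\<forall>f\<in>set F. 1 \<le> hdeg f" "kappa_pt F x \<le> ereal K"
  shows "1 \<le> 2 * K\<^sup>2"
proof -
  note k = kappa_pt_le_imp[OF assms]
  have t: "tnorm F > 0" using assms(1) tnorm_nonneg[of F] by simp
  have "F \<noteq> []" using assms(1) by (auto simp: tnorm_def)
  then have "(if surj_tangent F x then 1 / (pinv_delta_norm F x * tnorm F) else 0)\<^sup>2 \<le> 1"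
    using pinv_delta_norm_ge[OF _ assms(2) _ assms(3)] by (auto intro!: power_le_one)
  moreover have "lnorm (tval F x) \<le> 1 * tnorm F"
    by (rule lnorm_tval_le) (use peval_bound[OF assms(2)] in auto)
  then have "(lnorm (tval F x) / tnorm F)\<^sup>2 \<le> 1"
    using t by (intro power_le_one) (auto simp: lnorm_nonneg)
  ultimately have "1 / K\<^sup>2 \<le> 2" using k(2) by linarith
  then show ?thesis using k(1) by (simp add: field_simps)
qed

text \<open>The value term uses at most 1/16 of the lower bound 1/K^2 on the radicand, so the
  derivative term keeps 15/16 of it. Being nonzero, it forces surjectivity, and mu_proj^2 <= (16/15)
  K^2 < (9/4) K^2.\<close>

lemma kappa_pt_le_imp_surj:
  fixes x :: "real^'n::finite"
  assumes "tnorm F \<noteq> 0" "norm x = 1" "\<forall>f\<in>set F. 1 \<le> hdeg f" "kappa_pt F x \<le> ereal K"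
    and small: "lnorm (tval F x) \<le> 1 / (4 * K) * tnorm F"
  shows "surj_tangent F x" "pinv_delta_norm F x * tnorm F < 3/2 * K"
proof -
  note k = kappa_pt_le_imp[OF assms(1-4)]
  let ?e = "if surj_tangent F x then 1 / (pinv_delta_norm F x * tnorm F) else 0"
  have t: "tnorm F > 0" using assms(1) tnorm_nonneg[of F] by simp
  have "lnorm (tval F x) / tnorm F \<le> 1 / (4 * K)"
    using small t by (simp only: pos_divide_le_eq)
  then have "(lnorm (tval F x) / tnorm F)\<^sup>2 \<le> (1 / (4 * K))\<^sup>2"
    using t by (intro power_mono) (auto simp: lnorm_nonneg)
  also have "\<dots> = 1/16 * (1 / K\<^sup>2)" by (simp add: power_divide power_mult_distrib)
  finally have e: "15/16 * (1 / K\<^sup>2) \<le> ?e\<^sup>2" using k(2) by linarith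
  moreover have "1 / K\<^sup>2 > 0" using k(1) by simp
  ultimately have "?e\<^sup>2 > 0" by linarith
  then show s: "surj_tangent F x" by (auto split: if_splits)
  let ?m = "pinv_delta_norm F x * tnorm F"
  have "F \<noteq> []" using assms(1) by (auto simp: tnorm_def)
  then have m: "?m \<ge> 1" using pinv_delta_norm_ge[OF s assms(2) _ assms(3)] by auto
  have "15/16 * (1 / K\<^sup>2) \<le> 1 / ?m\<^sup>2" using e s by (simp add: power_divide)
  moreover have "?m\<^sup>2 > 0" using m by (intro zero_less_power) linarith
  ultimately have "15/16 * (1 / K\<^sup>2) * ?m\<^sup>2 \<le> 1" by (simp only: pos_le_divide_eq)
  then have "15/16 * ?m\<^sup>2 \<le> K\<^sup>2" using k(1) by (simp add: field_simps)
  moreover have "K\<^sup>2 > 0" using k(1) by simp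
  ultimately have "?m\<^sup>2 < (3/2)\<^sup>2 * K\<^sup>2" by (simp add: power2_eq_square)
  then have "?m\<^sup>2 < (3/2 * K)\<^sup>2" by (simp only: power_mult_distrib)
  then show "?m < 3/2 * K" using k(1) by (intro power2_less_imp_less[of ?m]) auto
qed

subsection \<open>Descent of the residual\<close>

text \<open>Squaring removes the kink: at 0 the difference quotient is bounded by |h|. Hence the
  square of the residual is differentiable along great circles even where an inequality is
  tight.\<close>

lemma DERIV_min_0_square: "((\<lambda>s::real. (min s 0)\<^sup>2) has_real_derivative 2 * min s 0) (at s)"
proof -
  consider "s < 0" | "s > 0" | "s = 0" by linarith
  then show ?thesis
  proof cases
    case 1
    have "((\<lambda>s::real. s\<^sup>2) has_real_derivative 2 * s) (at s)" by (auto intro!: derivative_eq_intros)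
    then have "((\<lambda>s::real. (min s 0)\<^sup>2) has_real_derivative 2 * s) (at s)"
      by (rule has_field_derivative_transform_within_open[where S = "{..<0}"]) (use 1 in auto)
    then show ?thesis using 1 by simp
  next
    case 2
    have "((\<lambda>s::real. 0) has_real_derivative 0) (at s)" by simp
    then have "((\<lambda>s::real. (min s 0)\<^sup>2) has_real_derivative 0) (at s)"
      by (rule has_field_derivative_transform_within_open[where S = "{0<..}"]) (use 2 in auto)
    then show ?thesis using 2 by simp
  next
    case 3
    have "((\<lambda>h::real. (min h 0)\<^sup>2 / h) \<longlongrightarrow> 0) (at 0)"
    proof (rule Lim_null_comparison[where g = abs])
      show "\<forall>\<^sub>F h in at 0. norm ((min h 0)\<^sup>2 / h) \<le> \<bar>h::real\<bar>"
        by (auto simp: eventually_at_filter min_def power2_eq_square)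
    qed (auto intro: tendsto_eq_intros)
    then show ?thesis using 3 by (simp add: DERIV_def)
  qed
qed

lemma DERIV_min_0_square_comp:
  assumes "(h has_real_derivative D) (at t)"
  shows "((\<lambda>t. (min (h t) 0)\<^sup>2) has_real_derivative 2 * min (h t) 0 * D) (at t)"
  using DERIV_chain2[OF DERIV_min_0_square assms] .

definition residual :: "('n::finite) hpoly list \<Rightarrow> 'n hpoly list \<Rightarrow> real^'n \<Rightarrow> real" where
  "residual F G z = sqrt ((\<Sum>i<length F. (peval (F!i) z)\<^sup>2) + (\<Sum>i<length G. (min (peval (G!i) z) 0)\<^sup>2))"

text \<open>The tuple $F^L$, with the subtuple $L$ of $G$ given by its index set.\<close>
definition append_at :: "('n::finite) hpoly list \<Rightarrow> 'n hpoly list \<Rightarrow> nat set \<Rightarrow> 'n hpoly list" where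
  "append_at F G I = F @ map ((!) G) (sorted_list_of_set I)"

lemma sum_list_sorted_list_of_set:
  "finite I \<Longrightarrow> (\<Sum>i\<leftarrow>sorted_list_of_set I. h i) = (\<Sum>i\<in>I. h i)"
  by (simp add: sum_list_distinct_conv_sum_set)

text \<open>A Newton step as descent direction. Let w be the minimal tangent vector whose
  derivatives equal the residual vector u. Along -w/|w| the residual has derivative -|u|/|w|, and
  |w| <= M |u| with M the norm of the pseudoinverse composed with \<open>Delta\<close>; so its rate
  of decrease is at least 1/M > c.\<close>

lemma residual_descent:
  fixes y :: "real^'n::finite"
  assumes y: "norm y = 1" and I: "I \<subseteq> {..<length G}"
    and surj: "surj_tangent (append_at F G I) y"
    and deg: "\<forall>f\<in>set (F @ G). 1 \<le> hdeg f"
    and inactive: "\<And>i. i < length G \<Longrightarrow> i \<notin> I \<Longrightarrow> 0 \<le> peval (G!i) y"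
    and pos: "0 < residual F G y"
    and c: "0 < c" "c * pinv_delta_norm (append_at F G I) y < 1"
  shows "\<exists>z. norm z = 1 \<and> residual F G z + c * norm (z - y) < residual F G y"
proof -
  let ?H = "append_at F G I"
  have fin: "finite I" using I finite_subset by blast
  \<comment> \<open>An inequality in I that holds at y gets the target derivative 0, matching its
    zero contribution to the residual.\<close>
  define u where "u = map (\<lambda>f. peval f y) F @ map (\<lambda>i. min (peval (G!i) y) 0) (sorted_list_of_set I)"
  have lu: "length u = length ?H" by (simp add: u_def append_at_def)
  have degH: "1 \<le> hdeg (?H!i)" if "i < length ?H" for i
  proof -
    have "?H!i \<in> set ?H" using that by (rule nth_mem)
    moreover have "set ?H \<subseteq> set (F @ G)" using I fin by (auto simp: append_at_def)
    ultimately show ?thesis using deg by blast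
  qed
  have uphi: "lnorm u = residual F G y"
  proof -
    have "(\<Sum>i<length G. (min (peval (G!i) y) 0)\<^sup>2) = (\<Sum>i\<in>I. (min (peval (G!i) y) 0)\<^sup>2)"
      by (rule sum.mono_neutral_right) (use I inactive in auto)
    then show ?thesis
      by (simp add: u_def lnorm_def residual_def o_def sum_list_sorted_list_of_set fin sum_list_map_eq_sum_nth[of _ F])
  qed
  have u0: "lnorm u > 0" using pos uphi by simp
  \<comment> \<open>Undoes the degree scaling in \<open>Delta\<close>; all degrees are at least 1,
    so this does not increase the norm.\<close>
  define u' where "u' = map (\<lambda>i. u!i / sqrt (hdeg (?H!i))) [0..<length ?H]"
  have lu': "length u' = length ?H" by (simp add: u'_def)
  have Du': "Delta ?H u' = u"
  proof (rule nth_equalityI)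
    fix i assume "i < length (Delta ?H u')"
    then have i: "i < length ?H" by (simp add: length_Delta[OF lu'])
    have "sqrt (hdeg (?H!i)) \<noteq> 0" using degH[OF i] by simp
    moreover have "u' ! i = u ! i / sqrt (hdeg (?H!i))" unfolding u'_def using i by simp
    ultimately show "Delta ?H u' ! i = u ! i" unfolding nth_Delta[OF lu' i] by simp
  qed (simp add: length_Delta[OF lu'] lu)
  have "lnorm u' = L2_set (\<lambda>i. \<bar>u' ! i\<bar>) {..<length ?H}" by (simp add: lnorm_eq_L2 lu' L2_set_def)
  also have "\<dots> \<le> L2_set (\<lambda>i. \<bar>u ! i\<bar>) {..<length ?H}"
  proof (rule L2_set_mono)
    fix i assume "i \<in> {..<length ?H}"
    then have i: "i < length ?H" by simp
    have "1 \<le> sqrt (hdeg (?H!i))" using degH[OF i] by simp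
    then have "\<bar>u!i\<bar> / sqrt (hdeg (?H!i)) \<le> \<bar>u!i\<bar> / 1" by (intro divide_left_mono) auto
    then show "\<bar>u' ! i\<bar> \<le> \<bar>u ! i\<bar>" using i by (simp add: u'_def abs_divide)
  qed auto
  also have "\<dots> = lnorm u" by (simp add: lnorm_eq_L2 lu L2_set_def)
  finally have lnu: "lnorm u' \<le> lnorm u" .
  obtain v0 where "v0 \<in> tangent y" "tderiv ?H y v0 = u"
    using surj lu unfolding surj_tangent_def by metis
  note w = pinv_properties[OF this]
  let ?w = "pinv ?H y u"
  have "?H \<noteq> []" using u0 lu by (auto simp: lnorm_def)
  moreover have "\<forall>f\<in>set ?H. 1 \<le> hdeg f" using degH by (metis in_set_conv_nth)
  ultimately have M1: "1 \<le> pinv_delta_norm ?H y * tnorm ?H" by (intro pinv_delta_norm_ge surj y)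
  have M: "pinv_delta_norm ?H y > 0"
    using M1 tnorm_nonneg[of ?H] by (metis less_le_trans linorder_not_less mult_nonpos_nonneg zero_less_one)
  have "norm ?w \<le> pinv_delta_norm ?H y * lnorm u'"
    using norm_pinv_Delta_le[OF surj lu'] by (simp add: Du')
  also have "\<dots> \<le> pinv_delta_norm ?H y * lnorm u" using lnu M by simp
  finally have "c * norm ?w \<le> c * pinv_delta_norm ?H y * lnorm u"
    using c(1) by (simp add: mult.assoc)
  also have "\<dots> < 1 * lnorm u" using c(2) u0 by (rule mult_strict_right_mono)
  finally have cw: "c * norm ?w < lnorm u" by simp
  have Dw: "frechet_derivative (peval (?H!i)) (at y) ?w = u ! i" if "i < length ?H" for i
    using w(2) that by (metis nth_tderiv)
  have DwF: "frechet_derivative (peval (F!i)) (at y) ?w = peval (F!i) y" if "i < length F" for i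
  proof -
    have "i < length ?H" "?H!i = F!i" "u!i = peval (F!i) y"
      using that by (simp_all add: append_at_def u_def nth_append)
    then show ?thesis using Dw by metis
  qed
  have DwG: "frechet_derivative (peval (G!i)) (at y) ?w = min (peval (G!i) y) 0" if "i \<in> I" for i
  proof -
    have "i \<in> set (sorted_list_of_set I)" using that fin by simp
    then obtain k where k: "k < card I" "sorted_list_of_set I ! k = i"
      unfolding in_set_conv_nth length_sorted_list_of_set by blast
    then have "length F + k < length ?H" "?H!(length F + k) = G!i" "u!(length F + k) = min (peval (G!i) y) 0"
      by (simp_all add: append_at_def u_def nth_append)
    then show ?thesis using Dw by metis
  qed
  have w0: "norm ?w > 0"
  proof -
    have "?w \<noteq> 0"
    proof
      assume "?w = 0"
      then have "u ! i = 0" if "i < length ?H" for i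
        using Dw[OF that] by (simp add: linear_0[OF linear_frechet_peval])
      then have "lnorm u = 0" by (simp add: lnorm_eq_L2 lu L2_set_eq_0_iff)
      then show False using u0 by simp
    qed
    then show ?thesis by simp
  qed
  define v where "v = (- 1 / norm ?w) *\<^sub>R ?w"
  have v: "norm v = 1" "y \<bullet> v = 0" using w0 w(1) by (auto simp: v_def tangent_def)
  have Dv: "frechet_derivative (peval p) (at y) v = - frechet_derivative (peval p) (at y) ?w / norm ?w" for p
    unfolding v_def linear_scale[OF linear_frechet_peval] by simp
  let ?g = "geo y v"
  let ?sq = "\<lambda>z. (\<Sum>i<length F. (peval (F!i) z)\<^sup>2) + (\<Sum>i<length G. (min (peval (G!i) z) 0)\<^sup>2)"
  have sq: "?sq y = (lnorm u)\<^sup>2" unfolding uphi residual_def by (simp add: sum_nonneg)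
  have dA: "((\<lambda>t. ?sq (?g t)) has_real_derivative
      (\<Sum>i<length F. 2 * peval (F!i) y * frechet_derivative (peval (F!i)) (at y) v) +
      (\<Sum>i<length G. 2 * min (peval (G!i) y) 0 * frechet_derivative (peval (G!i)) (at y) v)) (at 0)"
  proof (intro DERIV_add DERIV_sum)
    fix i
    show "((\<lambda>t. (peval (F!i) (?g t))\<^sup>2) has_real_derivative
       2 * peval (F!i) y * frechet_derivative (peval (F!i)) (at y) v) (at 0)"
      using DERIV_power[OF peval_geo_deriv[of "F!i" y v], of 2] by (simp add: mult_ac)
    show "((\<lambda>t. (min (peval (G!i) (?g t)) 0)\<^sup>2) has_real_derivative
       2 * min (peval (G!i) y) 0 * frechet_derivative (peval (G!i)) (at y) v) (at 0)"
      using DERIV_min_0_square_comp[OF peval_geo_deriv[of "G!i" y v]] by simp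
  qed
  have dF: "(\<Sum>i<length F. 2 * peval (F!i) y * frechet_derivative (peval (F!i)) (at y) v)
     = (\<Sum>i<length F. - 2 / norm ?w * (peval (F!i) y)\<^sup>2)"
    by (intro sum.cong refl) (simp add: Dv DwF power2_eq_square)
  have dG: "(\<Sum>i<length G. 2 * min (peval (G!i) y) 0 * frechet_derivative (peval (G!i)) (at y) v)
     = (\<Sum>i<length G. - 2 / norm ?w * (min (peval (G!i) y) 0)\<^sup>2)"
  proof (intro sum.cong refl)
    fix i assume "i \<in> {..<length G}"
    then show "2 * min (peval (G!i) y) 0 * frechet_derivative (peval (G!i)) (at y) v
        = - 2 / norm ?w * (min (peval (G!i) y) 0)\<^sup>2"
      using inactive[of i] by (cases "i \<in> I") (auto simp: Dv DwG power2_eq_square)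
  qed
  have dsq: "((\<lambda>t. ?sq (?g t)) has_real_derivative - 2 / norm ?w * (lnorm u)\<^sup>2) (at 0)"
    using dA unfolding dF dG sum_distrib_left[symmetric] distrib_left[symmetric] sq .
  have sq0: "?sq (?g 0) = (lnorm u)\<^sup>2" by (simp add: sq)
  \<comment> \<open>The square root is differentiable here because the residual at y is
    positive.\<close>
  have dS: "((\<lambda>t. sqrt (?sq (?g t))) has_real_derivative
     (inverse (sqrt (?sq (?g 0))) / 2) * (- 2 / norm ?w * (lnorm u)\<^sup>2)) (at 0)"
    by (rule DERIV_chain2[OF _ dsq]) (rule DERIV_real_sqrt, unfold sq0, use u0 in simp)
  have eq: "(inverse (sqrt (?sq (?g 0))) / 2) * (- 2 / norm ?w * (lnorm u)\<^sup>2) = - lnorm u / norm ?w"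
    unfolding sq0 using u0 w0 by (simp add: field_simps power2_eq_square)
  have "((\<lambda>t. residual F G (?g t)) has_real_derivative - lnorm u / norm ?w) (at 0)"
    using dS unfolding eq residual_def .
  then have "((\<lambda>t. residual F G (?g t) + c * t) has_real_derivative - lnorm u / norm ?w + c * 1) (at 0)"
    by (intro DERIV_add DERIV_cmult DERIV_ident)
  moreover have "- lnorm u / norm ?w + c * 1 < 0"
    using cw w0 by (simp add: field_simps)
  ultimately obtain d where d: "d > 0"
    "\<And>h. 0 < h \<Longrightarrow> h < d \<Longrightarrow> residual F G (?g (0 + h)) + c * (0 + h) < residual F G (?g 0) + c * 0"
    using DERIV_neg_dec_right by blast
  then have "residual F G (?g (d/2)) + c * (d/2) < residual F G y"
    using d(2)[of "d/2"] by simp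
  moreover have "c * norm (?g (d/2) - y) \<le> c * (d/2)"
    using norm_geo_diff[OF y v, of "d/2"] c(1) d(1) by simp
  ultimately have "residual F G (?g (d/2)) + c * norm (?g (d/2) - y) < residual F G y" by linarith
  then show ?thesis using norm_geo[OF y v] by blast
qed

subsection \<open>The error bound\<close>

lemma continuous_on_residual: "continuous_on S (residual F G)"
  unfolding residual_def by (intro continuous_intros continuous_on_peval)

lemma tnorm_append_at_sq:
  "finite I \<Longrightarrow> (tnorm (append_at F G I))\<^sup>2 = (\<Sum>i<length F. (wnorm (F!i))\<^sup>2) + (\<Sum>i\<in>I. (wnorm (G!i))\<^sup>2)"
  by (simp add: tnorm_def append_at_def o_def sum_list_sorted_list_of_set sum_list_map_eq_sum_nth[of _ F] sum_nonneg
      real_sqrt_pow2 add_nonneg_nonneg)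

lemma tnorm_append_at_mono:
  assumes "finite J" "I \<subseteq> J" shows "tnorm (append_at F G I) \<le> tnorm (append_at F G J)"
proof -
  have "(tnorm (append_at F G I))\<^sup>2 \<le> (tnorm (append_at F G J))\<^sup>2"
    unfolding tnorm_append_at_sq[OF assms(1)] tnorm_append_at_sq[OF finite_subset[OF assms(2,1)]]
    by (intro add_left_mono sum_mono2) (use assms in auto)
  then show ?thesis using tnorm_nonneg power2_le_imp_le by blast
qed

lemma length_append_at: "finite I \<Longrightarrow> length (append_at F G I) = length F + card I"
  by (simp add: append_at_def)

lemma set_append_at: "finite I \<Longrightarrow> set (append_at F G I) = set F \<union> (!) G ` I"
  by (simp add: append_at_def)

text \<open>The theorem for a real bound K on the condition numbers and for chordal distance; the
  radius 3/2 K r leaves room for the factor 2 lost in passing to geodesic distance.\<close>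

lemma Approx_near_semialg:
  fixes F G :: "('n::finite) hpoly list"
  assumes deg: "\<forall>p\<in>set (F @ G). 1 \<le> hdeg p"
    and len: "length F \<le> CARD('n)" and F: "F \<noteq> []" and r: "0 < r"
    and kap: "\<And>I y. \<lbrakk>I \<subseteq> {..<length G}; length F + card I \<le> CARD('n); norm y = 1\<rbrakk>
                 \<Longrightarrow> kappa_pt (append_at F G I) y \<le> ereal K"
    and D: "\<forall>p\<in>set (F @ G). real (hdeg p) \<le> D" "1 \<le> D"
    and small: "13 * sqrt D * K\<^sup>2 * r < 1"
    and x: "x \<in> Approx F G r"
  shows "\<exists>y\<in>semialg F G. norm (x - y) < 3/2 * K * r"
proof -
  have x1: "norm x = 1" using x by (simp add: Approx_def sphere_n_def)
  have xF: "\<bar>peval f x\<bar> < wnorm f * r" if "f \<in> set F" for f using x that by (simp add: Approx_def)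
  have xG: "peval g x > - wnorm g * r" if "g \<in> set G" for g using x that by (simp add: Approx_def)
  \<comment> \<open>The strict inequality |f(x)| < |f| r forces |f| > 0 for every member of
    F.\<close>
  have tn0: "0 < tnorm (append_at F G I)" if "finite I" for I
  proof -
    have h: "hd F \<in> set F" using F by simp
    have "0 < wnorm (hd F) * r" using xF[OF h] by linarith
    then have "0 < wnorm (hd F)" using r by (simp add: zero_less_mult_iff)
    also have "\<dots> \<le> tnorm (append_at F G I)" using h that by (intro wnorm_le_tnorm) (simp add: set_append_at)
    finally show ?thesis .
  qed
  have degI: "\<forall>f\<in>set (append_at F G I). 1 \<le> hdeg f" if "I \<subseteq> {..<length G}" for I
    using that deg finite_subset[OF that] by (auto simp: set_append_at)
  have k0: "kappa_pt (append_at F G {}) x \<le> ereal K"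
    by (rule kap) (use len x1 in auto)
  have t0: "tnorm (append_at F G {}) \<noteq> 0" using tn0[of "{}"] by simp
  have K: "0 < K" "1 \<le> 2 * K\<^sup>2"
    using kappa_pt_le_imp(1)[OF t0 x1 degI k0] kappa_pt_lower_bound[OF t0 x1 degI k0] by auto
  have K1: "1 \<le> 3/2 * K"
  proof (rule power2_le_imp_le)
    show "1\<^sup>2 \<le> (3/2 * K)\<^sup>2" using K(2) by (simp add: power_mult_distrib power_divide)
  qed (use K in simp)
  have sD: "1 \<le> sqrt D" using D by simp
  \<comment> \<open>This is where the constant 13 is spent. The left side bounds |h(y)|/|h|: r from
    the values at x, plus the Lipschitz change over the distance 3/2 K r. It is at most 3 sqrt(D) K
    r, and multiplying by 4 K gives 12 sqrt(D) K^2 r < 1.\<close>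
  have close: "r + sqrt D * (3/2 * K * r) \<le> 1 / (4 * K)"
  proof -
    have "r * 1 \<le> r * (3/2 * K)" using r K1 by (intro mult_left_mono) auto
    also have "\<dots> = 1 * (3/2 * K * r)" by simp
    also have "\<dots> \<le> sqrt D * (3/2 * K * r)" using sD r K by (intro mult_right_mono) auto
    finally have "r + sqrt D * (3/2 * K * r) \<le> 3 * sqrt D * K * r" by simp
    moreover have "3 * sqrt D * K * r * (4 * K) \<le> 1"
      using small sD r by (simp add: power2_eq_square mult_ac)
    ultimately show ?thesis using K by (subst pos_le_divide_eq) (auto intro: order_trans[OF mult_right_mono])
  qed
  have lip: "\<bar>peval p x - peval p y\<bar> \<le> wnorm p * (sqrt D * (3/2 * K * r))"
    if "p \<in> set (F @ G)" "norm y = 1" "norm (x - y) \<le> 3/2 * K * r" for p y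
  proof -
    have "\<bar>peval p x - peval p y\<bar> \<le> wnorm p * sqrt (hdeg p) * norm (x - y)"
      by (rule peval_lipschitz[OF x1 that(2)])
    also have "\<dots> \<le> wnorm p * sqrt D * (3/2 * K * r)"
      using that D by (intro mult_mono) (auto simp: wnorm_nonneg)
    finally show ?thesis by (simp add: mult.assoc)
  qed
  define Lx where "Lx = {i. i < length G \<and> peval (G!i) x < 0}"
  have Lx: "finite Lx" "Lx \<subseteq> {..<length G}" by (auto simp: Lx_def)
  define N where "N = tnorm (append_at F G Lx)"
  have N: "0 < N" using tn0 Lx by (simp add: N_def)
  \<comment> \<open>Strictness comes from the equations, F being nonempty; a violated inequality has
    |g(x)| < |g| r, and a satisfied one contributes nothing.\<close>
  have resx: "residual F G x < r * N"
  proof -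
    have "(\<Sum>i<length G. (min (peval (G!i) x) 0)\<^sup>2) = (\<Sum>i\<in>Lx. (peval (G!i) x)\<^sup>2)"
      by (rule sum.mono_neutral_cong_right) (auto simp: Lx_def)
    also have "\<dots> \<le> (\<Sum>i\<in>Lx. (wnorm (G!i) * r)\<^sup>2)"
    proof (intro sum_mono abs_le_square_iff[THEN iffD1])
      fix i assume "i \<in> Lx"
      then show "\<bar>peval (G!i) x\<bar> \<le> \<bar>wnorm (G!i) * r\<bar>"
        using xG[of "G!i"] r by (auto simp: Lx_def wnorm_nonneg abs_mult)
    qed
    also have "(\<Sum>i<length F. (peval (F!i) x)\<^sup>2) < (\<Sum>i<length F. (wnorm (F!i) * r)\<^sup>2)"
    proof (rule sum_strict_mono)
      fix i assume "i \<in> {..<length F}"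
      then have "\<bar>peval (F!i) x\<bar> < wnorm (F!i) * r" using xF[of "F!i"] by simp
      then show "(peval (F!i) x)\<^sup>2 < (wnorm (F!i) * r)\<^sup>2"
        by (metis abs_ge_zero power2_abs power_strict_mono pos2)
    qed (use F in auto)
    ultimately have "(\<Sum>i<length F. (peval (F!i) x)\<^sup>2) + (\<Sum>i<length G. (min (peval (G!i) x) 0)\<^sup>2)
        < (r * N)\<^sup>2"
      unfolding N_def power_mult_distrib tnorm_append_at_sq[OF Lx(1)]
      by (simp add: sum_distrib_left distrib_left mult.commute)
    then show ?thesis
      unfolding residual_def using r N by (intro real_less_lsqrt) auto
  qed
  \<comment> \<open>This slope balances two demands: c * (3/2 K r) = r N, which keeps the minimiser
    near x, and c < 1/M once M |F^L| < 3/2 K and N <= |F^L|.\<close>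
  define c where "c = 2 * N / (3 * K)"
  have c: "0 < c" using N K by (simp add: c_def)
  let ?\<Phi> = "\<lambda>z. residual F G z + c * norm (z - x)"
  have "\<exists>y\<in>sphere 0 1. \<forall>z\<in>sphere 0 1. ?\<Phi> y \<le> ?\<Phi> z"
    using x1 by (intro continuous_attains_inf) (auto intro!: continuous_intros continuous_on_residual)
  then obtain y where y1: "norm y = 1" and ymin: "\<And>z. norm z = 1 \<Longrightarrow> ?\<Phi> y \<le> ?\<Phi> z" by auto
  have res0: "0 \<le> residual F G y" by (simp add: residual_def sum_nonneg)
  have "c * norm (y - x) \<le> residual F G x" using ymin[OF x1] res0 by simp
  also have "\<dots> < c * (3/2 * K * r)" using resx K by (simp add: c_def mult.commute)
  finally have near: "norm (x - y) < 3/2 * K * r"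
    using c by (simp add: norm_minus_commute)
  have "residual F G y = 0"
  proof (rule ccontr)
    assume "residual F G y \<noteq> 0"
    then have pos: "0 < residual F G y" using res0 by simp
    \<comment> \<open>Including \<open>Lx\<close> ensures N <= |F^L|; including the violations at y
      leaves only inequalities that hold there, as \<open>residual_descent\<close> demands.\<close>
    define L where "L = Lx \<union> {i. i < length G \<and> peval (G!i) y < 0}"
    have L: "finite L" "L \<subseteq> {..<length G}" "Lx \<subseteq> L" using Lx by (auto simp: L_def)
    have act: "\<bar>peval p y\<bar> \<le> 1 / (4 * K) * wnorm p" if p: "p \<in> set (append_at F G L)" for p
    proof -
      have pFG: "p \<in> set (F @ G)" using p L by (auto simp: set_append_at)
      have l: "\<bar>peval p x - peval p y\<bar> \<le> wnorm p * (sqrt D * (3/2 * K * r))"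
        using lip[OF pFG y1] near by simp
      have wr: "0 \<le> wnorm p * r" using r by (simp add: wnorm_nonneg)
      consider "p \<in> set F" | "p \<in> set G" "peval p x < 0" | "p \<in> set G" "peval p y < 0"
        using p L(1,2) by (auto simp: set_append_at L_def Lx_def)
      then have "\<bar>peval p y\<bar> \<le> wnorm p * r + wnorm p * (sqrt D * (3/2 * K * r))"
      proof cases
        case 1 then show ?thesis using xF[OF 1] l by linarith
      next
        case 2 then show ?thesis using 2(2) xG[OF 2(1)] l wr unfolding abs_le_iff by linarith
      next
        case 3 then show ?thesis using 3(2) xG[OF 3(1)] l wr unfolding abs_le_iff by linarith
      qed
      also have "\<dots> \<le> wnorm p * (1 / (4 * K))"
        unfolding distrib_left[symmetric] using close by (intro mult_left_mono wnorm_nonneg)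
      finally show ?thesis by (simp add: mult.commute)
    qed
    \<comment> \<open>\<open>kap\<close> covers only tuples of at most n+1 polynomials, and F^L is
      not yet known to be one; hence the claim for every admissible subset of L.\<close>
    have good: "surj_tangent (append_at F G I) y"
      "pinv_delta_norm (append_at F G I) y * tnorm (append_at F G I) < 3/2 * K"
      if I: "I \<subseteq> L" "length F + card I \<le> CARD('n)" for I
    proof -
      have I': "I \<subseteq> {..<length G}" "finite I" using I L finite_subset by auto
      have t: "tnorm (append_at F G I) \<noteq> 0" using tn0[OF I'(2)] by simp
      have "lnorm (tval (append_at F G I) y) \<le> 1 / (4 * K) * tnorm (append_at F G I)"
        by (rule lnorm_tval_le) (use act I I' L K in \<open>auto simp: set_append_at\<close>)
      note k = kappa_pt_le_imp_surj[OF t y1 degI[OF I'(1)] kap[OF I'(1) I(2) y1] this]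
      show "surj_tangent (append_at F G I) y"
        "pinv_delta_norm (append_at F G I) y * tnorm (append_at F G I) < 3/2 * K" by (fact k)+
    qed
    \<comment> \<open>If too many constraints were nearly active, $n+1$ of them would be surjective on the
      $n$-dimensional tangent space.\<close>
    have cardL: "length F + card L \<le> CARD('n)"
    proof (rule ccontr)
      assume "\<not> ?thesis"
      then have "CARD('n) - length F \<le> card L" by simp
      then obtain I where I: "I \<subseteq> L" "card I = CARD('n) - length F"
        using obtain_subset_with_card_n by metis
      then have "length (append_at F G I) = CARD('n)"
        using len L(1) finite_subset by (subst length_append_at) auto
      then show False using not_surj_tangent_square[OF _ y1] good(1)[OF I(1)] I(2) len by auto
    qed
    let ?H = "append_at F G L"
    have M: "0 \<le> pinv_delta_norm ?H y"
    proof -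
      have "?H \<noteq> []" using F by (simp add: append_at_def)
      then have "1 \<le> pinv_delta_norm ?H y * tnorm ?H"
        using good(1)[OF order_refl cardL] y1 degI[OF L(2)] by (intro pinv_delta_norm_ge)
      then have "0 < pinv_delta_norm ?H y * tnorm ?H" by linarith
      then show ?thesis using tn0[OF L(1)] by (simp add: zero_less_mult_iff)
    qed
    have "c * pinv_delta_norm ?H y = 2 / (3 * K) * (pinv_delta_norm ?H y * N)" by (simp add: c_def)
    also have "\<dots> \<le> 2 / (3 * K) * (pinv_delta_norm ?H y * tnorm ?H)"
      unfolding N_def using M K tnorm_append_at_mono[OF L(1,3)] by (intro mult_left_mono) auto
    also have "\<dots> < 2 / (3 * K) * (3/2 * K)"
      using good(2)[OF order_refl cardL] K by (intro mult_strict_left_mono) auto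
    also have "\<dots> = 1" using K by simp
    finally have cM: "c * pinv_delta_norm ?H y < 1" .
    have "0 \<le> peval (G!i) y" if "i < length G" "i \<notin> L" for i
      using that by (auto simp: L_def not_less)
    from residual_descent[OF y1 L(2) good(1)[OF order_refl cardL] deg this pos c cM]
    obtain z where z: "norm z = 1" "residual F G z + c * norm (z - y) < residual F G y" by auto
    \<comment> \<open>By the triangle inequality the descent from y to z lowers the penalised
      function below its minimum.\<close>
    have "c * norm (z - x) \<le> c * (norm (z - y) + norm (y - x))"
      using c norm_triangle_ineq[of "z - y" "y - x"] by simp
    then show False using z(2) ymin[OF z(1)] by (simp add: distrib_left)
  qed
  then have s: "(\<Sum>i<length F. (peval (F!i) y)\<^sup>2) + (\<Sum>i<length G. (min (peval (G!i) y) 0)\<^sup>2) = 0"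
    by (simp add: residual_def)
  have "(\<Sum>i<length F. (peval (F!i) y)\<^sup>2) = 0 \<and> (\<Sum>i<length G. (min (peval (G!i) y) 0)\<^sup>2) = 0"
    using s by (subst (asm) add_nonneg_eq_0_iff) (auto simp: sum_nonneg)
  then have "\<forall>i<length F. peval (F!i) y = 0" "\<forall>i<length G. min (peval (G!i) y) 0 = 0"
    by (auto simp: sum_nonneg_eq_0_iff)
  note zeros = this
  have "peval f y = 0" if "f \<in> set F" for f
    using zeros(1) that by (metis in_set_conv_nth)
  moreover have "0 \<le> peval g y" if "g \<in> set G" for g
    using zeros(2) that by (metis in_set_conv_nth min.cobounded1)
  ultimately have "y \<in> semialg F G"
    using y1 unfolding semialg_def sphere_n_def by blast
  then show ?thesis using near by blast
qed

section \<open>From chordal to geodesic distance\<close>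

lemma sin_half_ge_quarter:
  fixes t :: real
  assumes "0 \<le> t" "t \<le> pi"
  shows "t / 4 \<le> sin (t / 2)"
proof -
  let ?v = "t / 4"
  have v: "0 \<le> ?v" "?v < pi / 2" using assms pi_gt_zero by linarith+
  have cos: "0 < cos ?v" by (rule cos_gt_zero_pi) (use v in linarith)+
  \<comment> \<open>With v = t/4, monotonicity of sin s - s cos s gives sin v >= v cos v. Doubling
    the angle, sin(t/2) >= 2 v cos^2 v = v (1 + cos(t/2)) >= v, as t/2 <= pi/2.\<close>
  have "sin 0 - 0 * cos 0 \<le> sin ?v - ?v * cos ?v"
  proof (rule DERIV_nonneg_imp_nondecreasing[OF v(1)])
    fix s :: real assume s: "0 \<le> s" "s \<le> ?v"
    have "((\<lambda>s. sin s - s * cos s) has_real_derivative s * sin s) (at s)"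
      by (auto intro!: derivative_eq_intros simp: algebra_simps)
    moreover have "0 \<le> s * sin s"
      using s v by (intro mult_nonneg_nonneg sin_ge_zero) auto
    ultimately show "\<exists>y. ((\<lambda>s. sin s - s * cos s) has_real_derivative y) (at s) \<and> 0 \<le> y" by blast
  qed
  then have "?v * cos ?v \<le> sin ?v" by simp
  then have "2 * (?v * cos ?v) * cos ?v \<le> 2 * sin ?v * cos ?v"
    using cos by (intro mult_right_mono) auto
  moreover have "2 * sin ?v * cos ?v = sin (t / 2)" using sin_double[of ?v] by simp
  moreover have "2 * (?v * cos ?v) * cos ?v = ?v * (1 + cos (t / 2))"
    using cos_double_cos[of ?v] by (simp add: power2_eq_square)
  moreover have "0 \<le> cos (t / 2)" by (rule cos_ge_zero) (use assms in auto)
  then have "?v * 1 \<le> ?v * (1 + cos (t / 2))" using v by (intro mult_left_mono) auto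
  ultimately show ?thesis by linarith
qed

lemma dist_S_le_chord:
  assumes x: "norm x = 1" and y: "norm y = 1"
  shows "dist_S x y \<le> 2 * norm (x - y)"
proof -
  define t where "t = arccos (x \<bullet> y)"
  have xy: "\<bar>x \<bullet> y\<bar> \<le> 1" using Cauchy_Schwarz_ineq2[of x y] assms by simp
  have ct: "cos t = x \<bullet> y" unfolding t_def using xy by (simp add: cos_arccos_abs)
  have t: "0 \<le> t" "t \<le> pi" using xy by (auto simp: t_def arccos_lbound arccos_ubound)
  have "(norm (x - y))\<^sup>2 = 2 * (1 - cos t)"
    using assms by (simp add: ct power2_norm_eq_inner inner_diff inner_commute norm_eq_1)
  also have "\<dots> = (2 * sin (t/2))\<^sup>2"
    using cos_double_sin[of "t/2"] by (simp add: power_mult_distrib)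
  finally have n: "norm (x - y) = 2 * sin (t/2)"
    using t by (subst (asm) power2_eq_iff_nonneg) (auto intro!: sin_ge_zero)
  have "t / 4 \<le> sin (t / 2)" using t by (intro sin_half_ge_quarter)
  then show ?thesis using n by (simp add: dist_S_def t_def)
qed

section \<open>The theorem for the extended-real condition number\<close>

lemma kappa_star_ge:
  assumes "I \<subseteq> {..<length G}" "length F + card I \<le> CARD('n)" "norm y = 1"
  shows "kappa_pt (append_at F G I) (y::real^'n::finite) \<le> kappa_star F G"
proof -
  have "kappa_pt (append_at F G I) y \<le> kappa (append_at F G I)"
    unfolding kappa_def by (rule SUP_upper) (use assms in \<open>simp add: sphere_n_def\<close>)
  also have "\<dots> \<le> kappa_star F G"
    unfolding kappa_star_def append_at_def by (rule SUP_upper) (use assms in simp)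
  finally show ?thesis .
qed

theorem theorem4p19:
  fixes F G :: "('n::finite) hpoly list" and r :: real
  assumes "\<forall>p\<in>set (F @ G). 1 \<le> hdeg p"
    and "length F \<le> CARD('n)"
    and "0 < r"
    and "ereal r < einv (ereal (13 * real (Max (hdeg ` set (F @ G))) powr (3/2)) * (kappa_star F G)\<^sup>2)"
  shows "Approx F G r \<subseteq> U_S (semialg F G) (3 * kappa_star F G * ereal r)"
proof
  fix x assume x: "x \<in> Approx F G r"
  then have x1: "norm x = 1" "x \<in> sphere_n" by (auto simp: Approx_def sphere_n_def)
  define D where "D = real (Max (hdeg ` set (F @ G)))"
  have kx: "kappa_pt (append_at F G {}) x \<le> kappa_star F G"
    by (rule kappa_star_ge) (use assms(2) x1 in auto)
  show "x \<in> U_S (semialg F G) (3 * kappa_star F G * ereal r)"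
  proof (cases "F @ G = []")
    case True
    \<comment> \<open>Here \<open>Max {}\<close> is unspecified, so the bound on \<open>r\<close> carries no information.\<close>
    then have "kappa_star F G = \<infinity>" using kx by (simp add: append_at_def kappa_pt_def tnorm_def)
    moreover have "x \<in> semialg F G" using True x1 by (simp add: semialg_def)
    then have "(INF a\<in>semialg F G. ereal (dist_S x a)) \<le> ereal (dist_S x x)" by (rule INF_lower)
    then have "(INF a\<in>semialg F G. ereal (dist_S x a)) < \<infinity>" by (rule le_less_trans) simp
    ultimately show ?thesis using x1 assms(3) by (simp add: U_S_def)
  next
    case False
    have Dge: "\<forall>p\<in>set (F @ G). real (hdeg p) \<le> D" by (auto simp: D_def)
    obtain p where "p \<in> set (F @ G)" using False by (metis list.set_intros(1) neq_Nil_conv)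
    then have D1: "1 \<le> D" using assms(1) Dge by force
    have P: "0 < 13 * D powr (3/2)" using D1 by simp
    \<comment> \<open>For an infinite condition number the bound on r would be \<open>einv\<close>
      of infinity, which is 0.\<close>
    have fin: "kappa_star F G \<noteq> \<infinity>"
    proof
      assume "kappa_star F G = \<infinity>"
      then have "ereal r < 0" using assms(4) P unfolding D_def[symmetric] by (simp add: power2_eq_square einv_def)
      then show False using assms(3) by simp
    qed
    \<comment> \<open>The empty tuple has infinite condition by convention, so an empty F would make
      \<open>kappa_star F G\<close> infinite.\<close>
    then have F: "F \<noteq> []" using kx by (auto simp: append_at_def kappa_pt_def tnorm_def)
    have t0: "tnorm (append_at F G {}) \<noteq> 0"
      using kx fin by (auto simp: kappa_pt_def)
    have deg0: "\<forall>f\<in>set (append_at F G {}). 1 \<le> hdeg f" using assms(1) by (simp add: append_at_def)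
    have "kappa_star F G \<noteq> -\<infinity>"
    proof
      assume "kappa_star F G = -\<infinity>"
      then have "kappa_pt (append_at F G {}) x \<le> ereal (-1)" using kx by simp
      from kappa_pt_le_imp(1)[OF t0 x1(1) deg0 this] show False by simp
    qed
    with fin obtain K where K: "kappa_star F G = ereal K" by (cases "kappa_star F G") auto
    have K0: "0 < K" by (rule kappa_pt_le_imp(1)[OF t0 x1(1) deg0]) (use kx K in simp)
    have "r < 1 / (13 * D powr (3/2) * K\<^sup>2)"
      using assms(4) K0 D1 unfolding D_def[symmetric] K by (simp add: power2_eq_square einv_def)
    then have "13 * D powr (3/2) * K\<^sup>2 * r < 1"
      using P K0 by (simp add: field_simps)
    \<comment> \<open>The Lipschitz estimates consume \<open>sqrt D\<close>, which D^(3/2) dominates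
      because D >= 1.\<close>
    moreover have "sqrt D \<le> D powr (3/2)"
      using D1 by (simp add: powr_half_sqrt[symmetric] powr_mono)
    then have "13 * sqrt D * K\<^sup>2 * r \<le> 13 * D powr (3/2) * K\<^sup>2 * r"
      using assms(3) by (intro mult_right_mono mult_left_mono) auto
    ultimately have small: "13 * sqrt D * K\<^sup>2 * r < 1" by linarith
    obtain y where y: "y \<in> semialg F G" "norm (x - y) < 3/2 * K * r"
      using Approx_near_semialg[OF assms(1,2) F assms(3) _ Dge D1 small x] kappa_star_ge[of _ G F] K by auto
    have "(INF a\<in>semialg F G. ereal (dist_S x a)) \<le> ereal (dist_S x y)" using y(1) by (rule INF_lower)
    also have "dist_S x y \<le> 2 * norm (x - y)"
      using x1 y(1) by (intro dist_S_le_chord) (auto simp: semialg_def sphere_n_def)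
    also have "\<dots> < 3 * K * r" using y(2) by simp
    finally show ?thesis using x1 by (simp add: U_S_def K)
  qed
qed

end
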